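(* Let $f=(f_1,\ldots,f_m)\colon\mathbb{R}^n\to\mathbb{R}^m$ be a polynomial map. Suppose that $f$ is convenient and Khovanskii non-degenerate at infinity. If there exists $\bar t\in f(\mathbb{R}^n)$ such that the section $[f(\mathbb{R}^n)]_{\bar t}$ is bounded, then the problem $\mathrm{Min}_{\,\mathbb{R}^m_+}\{f(x)\mid x\in\mathbb{R}^n\}$ admits a Pareto solution.
   Context: $n,m\ge1$; $\mathbb{R}^m_+$ is the nonnegative orthant. A point $x^*\in\mathbb{R}^n$ is a Pareto solution of the problem if $f(x)\notin f(x^* )-(\mathbb{R}^m_+\setminus\{0\})$ for all $x\in\mathbb{R}^n$. For $A\subset\mathbb{R}^m$ and $\bar t\in\mathbb{R}^m$, the section of $A$ at $\bar t$ is $[A]_{\bar t}:=A\cap(\bar t-\mathbb{R}^m_+)$. It is called bounded if there is $a\in\mathbb{R}^m$ with $[A]_{\bar t}\subset a+\mathbb{R}^m_+$. For $\kappa=(\kappa_1,\ldots,\kappa_n)\in\mathbb{N}^n$ (with $0\in\mathbb{N}$) write $x^\kappa=x_1^{\kappa_1}\cdots x_n^{\kappa_n}$. For a polynomial function $g=\sum_\kappa a_\kappa x^\kappa\colon\mathbb{R}^n\to\mathbb{R}$, the Newton polyhedron at infinity $\mathcal{N}(g)$ is the convex hull in $\mathbb{R}^n$ of $\{\kappa\mid a_\kappa\ne0\}\cup\{0\}$. The polynomial $g$ is convenient if $\mathcal{N}(g)$ intersects each coordinate axis in a point different from the origin. For a face $\Delta$ of $\mathcal{N}(g)$, the principal part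 $g_\Delta$ is the sum of the terms $a_\kappa x^\kappa$ with $\kappa\in\Delta$. The map $f=(f_1,\ldots,f_m)$ is convenient if all components $f_i$ are convenient. Let $\mathcal{N}(f):=\mathcal{N}(f_1)+\cdots+\mathcal{N}(f_m)$ be the Minkowski sum, and let $\mathcal{N}_\infty(f)$ be the set of (nonempty) faces of $\mathcal{N}(f)$ not containing the origin. Each face $\Delta$ of $\mathcal{N}(f)$ has a unique decomposition $\Delta=\Delta_1+\cdots+\Delta_m$ with $\Delta_i$ a face of $\mathcal{N}(f_i)$; put $f_\Delta:=(f_{1,\Delta_1},\ldots,f_{m,\Delta_m})\colon\mathbb{R}^n\to\mathbb{R}^m$, where $f_{i,\Delta_i}$ is the principal part of $f_i$ with respect to $\Delta_i$. $f$ is Khovanskii non-degenerate at infinity if for every face $\Delta\in\mathcal{N}_\infty(f)$ and every $x\in(\mathbb{R}\setminus\{0\})^n\cap f_\Delta^{-1}(0)$, the $m\times n$ matrix with entries $x_j\frac{\partial f_{i,\Delta_i}}{\partial x_j}(x)$ ($i=1,\ldots,m$, $j=1,\ldots,n$) has rank $m$. *)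

theory Defs
  imports "HOL-Analysis.Analysis" "HOL-Library.Poly_Mapping" "HOL-Library.Set_Algebras"
begin

text \<open>
  A polynomial in the variables indexed by \<open>'n\<close> is represented by its finitely supported family
  of coefficients, indexed by exponent vectors; a polynomial map has one such family per component.
\<close>

type_synonym 'n polynomial = "(nat ^ 'n) \<Rightarrow>\<^sub>0 real"

definition monomial :: "nat ^ 'n \<Rightarrow> real ^ 'n \<Rightarrow> real" where
  "monomial \<kappa> x = (\<Prod>j\<in>UNIV. (x $ j) ^ (\<kappa> $ j))"

definition poly_fun :: "'n::finite polynomial \<Rightarrow> real ^ 'n \<Rightarrow> real" where
  "poly_fun g x = (\<Sum>\<kappa>\<in>Poly_Mapping.keys g. Poly_Mapping.lookup g \<kappa> * monomial \<kappa> x)"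

definition poly_map :: "'n::finite polynomial ^ 'm \<Rightarrow> real ^ 'n \<Rightarrow> real ^ 'm" where
  "poly_map p x = (\<chi> i. poly_fun (p $ i) x)"

definition real_exponent :: "nat ^ 'n \<Rightarrow> real ^ 'n" where
  "real_exponent \<kappa> = (\<chi> j. real (\<kappa> $ j))"

definition newton_polyhedron :: "'n::finite polynomial \<Rightarrow> (real ^ 'n) set" where
  "newton_polyhedron g = convex hull (real_exponent ` Poly_Mapping.keys g \<union> {0})"

definition convenient :: "'n::finite polynomial \<Rightarrow> bool" where
  "convenient g \<longleftrightarrow> (\<forall>j. \<exists>c. c \<noteq> 0 \<and> axis j c \<in> newton_polyhedron g)"

definition convenient_map :: "'n::finite polynomial ^ 'm \<Rightarrow> bool" where
  "convenient_map p \<longleftrightarrow> (\<forall>i. convenient (p $ i))"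

definition principal_part :: "'n::finite polynomial \<Rightarrow> (real ^ 'n) set \<Rightarrow> real ^ 'n \<Rightarrow> real" where
  "principal_part g \<Delta> x =
     (\<Sum>\<kappa> | \<kappa> \<in> Poly_Mapping.keys g \<and> real_exponent \<kappa> \<in> \<Delta>. Poly_Mapping.lookup g \<kappa> * monomial \<kappa> x)"

text \<open>The sum is the Minkowski sum, by the addition of sets from \<open>Set_Algebras\<close>.\<close>

definition newton_polyhedron_map :: "'n::finite polynomial ^ 'm \<Rightarrow> (real ^ 'n) set" where
  "newton_polyhedron_map p = (\<Sum>i\<in>UNIV. newton_polyhedron (p $ i))"

definition faces_at_infinity :: "'n::finite polynomial ^ 'm \<Rightarrow> (real ^ 'n) set set" where
  "faces_at_infinity p = {\<Delta>. \<Delta> face_of newton_polyhedron_map p \<and> \<Delta> \<noteq> {} \<and> 0 \<notin> \<Delta>}"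

definition face_decomposition ::
    "'n::finite polynomial ^ 'm \<Rightarrow> (real ^ 'n) set \<Rightarrow> ('m \<Rightarrow> (real ^ 'n) set) \<Rightarrow> bool" where
  "face_decomposition p \<Delta> D \<longleftrightarrow>
     (\<forall>i. D i face_of newton_polyhedron (p $ i)) \<and> \<Delta> = (\<Sum>i\<in>UNIV. D i)"

definition principal_part_map ::
    "'n::finite polynomial ^ 'm \<Rightarrow> ('m \<Rightarrow> (real ^ 'n) set) \<Rightarrow> real ^ 'n \<Rightarrow> real ^ 'm" where
  "principal_part_map p D x = (\<chi> i. principal_part (p $ i) (D i) x)"

definition toric_jacobian :: "(real ^ 'n \<Rightarrow> real ^ 'm) \<Rightarrow> real ^ 'n \<Rightarrow> real ^ 'n ^ 'm" where
  "toric_jacobian F x = (\<chi> i j. x $ j * jacobian F (at x) $ i $ j)"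

text \<open>
  A nonempty face \<open>\<Delta>\<close> of a Minkowski sum of polytopes has exactly one decomposition \<open>D\<close> into faces
  of the summands, so the quantifier over \<open>D\<close> merely names that decomposition.
\<close>

definition khovanskii_nondegenerate :: "'n::finite polynomial ^ 'm \<Rightarrow> bool" where
  "khovanskii_nondegenerate p \<longleftrightarrow>
     (\<forall>\<Delta>\<in>faces_at_infinity p. \<forall>D. face_decomposition p \<Delta> D \<longrightarrow>
        (\<forall>x. (\<forall>j. x $ j \<noteq> 0) \<and> principal_part_map p D x = 0 \<longrightarrow>
           rank (toric_jacobian (principal_part_map p D) x) = CARD('m)))"

definition nonneg_orthant :: "(real ^ 'm) set" where
  "nonneg_orthant = {v. \<forall>i. 0 \<le> v $ i}"

definition set_section :: "(real ^ 'm) set \<Rightarrow> real ^ 'm \<Rightarrow> (real ^ 'm) set" where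
  "set_section A t = A \<inter> (\<lambda>v. t - v) ` nonneg_orthant"

text \<open>Boundedness of a section is boundedness from below with respect to the orthant.\<close>

definition section_bounded :: "(real ^ 'm) set \<Rightarrow> real ^ 'm \<Rightarrow> bool" where
  "section_bounded A t \<longleftrightarrow> (\<exists>a. set_section A t \<subseteq> (\<lambda>v. a + v) ` nonneg_orthant)"

definition pareto_solution :: "(real ^ 'n \<Rightarrow> real ^ 'm) \<Rightarrow> real ^ 'n \<Rightarrow> bool" where
  "pareto_solution f x \<longleftrightarrow> (\<forall>y. f y \<notin> (\<lambda>v. f x - v) ` (nonneg_orthant - {0}))"

end

theory Submission
  imports Defs
begin

text \<open>
  Let \<open>S = {x. f x \<le> t}\<close>, on which \<open>f\<close> is bounded. It suffices to minimise \<open>\<Sum>\<^sub>i f\<^sub>i\<close> over \<open>S\<close>, and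
  a minimiser exists as soon as all points of \<open>S\<close> far from the origin admit a unit vector along
  which every \<open>f\<^sub>i\<close> decreases at a uniform rate.

  Suppose that such directions fail along a sequence \<open>x\<^sup>k \<rightarrow> \<infinity>\<close> with \<open>f x\<^sup>k\<close> bounded and, after a
  perturbation, with nonzero coordinates. No curve selection is needed: for \<open>u = (ln \<bar>x\<^sub>j\<^sup>k\<bar>)\<^sub>j\<close>, pass
  to a subsequence along which the maximiser \<open>\<mu>\<^sub>i\<close> of \<open>\<kappa> \<bullet> u\<close> over the exponents of \<open>f\<^sub>i\<close> is constant
  and each gap \<open>(\<mu>\<^sub>i - \<kappa>) \<bullet> u\<close> either converges or tends to infinity. Splitting off from \<open>u\<close> the
  orthogonal projection \<open>v\<close> to the span of the converging gap vectors leaves \<open>w = u - v\<close>, where \<open>v\<close>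
  converges and \<open>w\<close>, eventually, exposes a fixed face \<open>\<Delta>\<close> not containing the origin. Rescaled by
  \<open>exp (\<mu>\<^sub>i \<bullet> w)\<close>, the values \<open>f\<^sub>i x\<^sup>k\<close> and the toric derivatives converge to those of the principal
  part at a point of the torus. As \<open>f\<close> is bounded, the limit is a zero of \<open>f\<^sub>\<Delta>\<close>, and
  non-degeneracy provides a vector \<open>y\<close> that the toric Jacobian maps to \<open>(1, \<dots>, 1)\<close>. Then
  \<open>- (x\<^sub>j\<^sup>k y\<^sub>j)\<^sub>j\<close>, normalised, is a descent direction, with a rate bounded below because
  \<open>exp (\<mu>\<^sub>i \<bullet> w)\<close> dominates \<open>\<parallel>x\<^sup>k\<parallel>\<close> by convenience.
\<close>

subsection \<open>Derivatives of principal parts\<close>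

text \<open>Omitting index \<open>j\<close> from the product, instead of dividing by
  \<open>x $ j\<close>, keeps the formula valid on the coordinate hyperplanes. For
  \<open>\<kappa> $ j = 0\<close> the leading factor kills the truncated power.\<close>

definition monomial_gradient :: "nat ^ 'n \<Rightarrow> real ^ 'n \<Rightarrow> real ^ 'n::finite" where
  "monomial_gradient \<kappa> x =
     (\<chi> j. real (\<kappa> $ j) * (x $ j) ^ (\<kappa> $ j - 1) * (\<Prod>l\<in>UNIV - {j}. (x $ l) ^ (\<kappa> $ l)))"

lemma has_derivative_monomial:
  "(monomial \<kappa> has_derivative (\<lambda>h. monomial_gradient \<kappa> x \<bullet> h)) (at x)"
proof -
  have "((\<lambda>x. \<Prod>j\<in>UNIV. (x $ j) ^ (\<kappa> $ j)) has_derivative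
      (\<lambda>h. \<Sum>j\<in>UNIV. (real (\<kappa> $ j) * h $ j * (x $ j) ^ (\<kappa> $ j - 1)) *
        (\<Prod>l\<in>UNIV - {j}. (x $ l) ^ (\<kappa> $ l)))) (at x)"
    by (intro has_derivative_prod has_derivative_power)
      (auto intro!: bounded_linear_imp_has_derivative bounded_linear_vec_nth)
  then show ?thesis
    by (simp add: monomial_def[abs_def] monomial_gradient_def inner_vec_def mult_ac)
qed

text \<open>Monomials are eigenfunctions of the operators x_j d/dx_j, so toric derivatives of a
  polynomial are combinations of its own monomials, and one limit argument serves values and
  derivatives alike.\<close>

lemma toric_monomial_gradient:
  "x $ j * monomial_gradient \<kappa> x $ j = real (\<kappa> $ j) * monomial \<kappa> x"
proof (cases "\<kappa> $ j = 0")
  case False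
  then have "x $ j * x $ j ^ (\<kappa> $ j - 1) = x $ j ^ (\<kappa> $ j)"
    by (simp add: power_eq_if)
  then show ?thesis
    by (simp add: monomial_def monomial_gradient_def prod.remove[of UNIV j] mult_ac)
qed (simp add: monomial_gradient_def)

lemma continuous_monomial_gradient: "continuous_on S (monomial_gradient \<kappa>)"
  unfolding monomial_gradient_def[abs_def]
  by (intro continuous_on_vec_lambda continuous_intros)

lemma tendsto_monomial:
  assumes "(z \<longlongrightarrow> a) F"
  shows "((\<lambda>k. monomial \<kappa> (z k)) \<longlongrightarrow> monomial \<kappa> a) F"
  unfolding monomial_def using assms by (intro tendsto_intros)

lemma monomial_exp_scale:
  assumes "\<And>j. x $ j = z $ j * exp (w $ j)"
  shows "monomial \<kappa> x = monomial \<kappa> z * exp (real_exponent \<kappa> \<bullet> w)"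
  by (simp add: monomial_def assms real_exponent_def inner_vec_def exp_sum power_mult_distrib
      prod.distrib exp_of_nat_mult)

definition principal_gradient :: "'n::finite polynomial \<Rightarrow> (real ^ 'n) set \<Rightarrow> real ^ 'n \<Rightarrow> real ^ 'n" where
  "principal_gradient g \<Delta> x =
     (\<Sum>\<kappa> | \<kappa> \<in> Poly_Mapping.keys g \<and> real_exponent \<kappa> \<in> \<Delta>.
        Poly_Mapping.lookup g \<kappa> *\<^sub>R monomial_gradient \<kappa> x)"

lemma has_derivative_principal_part:
  "(principal_part g \<Delta> has_derivative (\<lambda>h. principal_gradient g \<Delta> x \<bullet> h)) (at x)"
  unfolding principal_part_def[abs_def] principal_gradient_def inner_sum_left inner_scaleR_left
  by (intro has_derivative_sum has_derivative_mult_right has_derivative_monomial)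

lemma poly_fun_eq_principal_part: "poly_fun g = principal_part g UNIV"
  by (simp add: fun_eq_iff poly_fun_def principal_part_def)

lemma continuous_principal_gradient: "continuous_on S (principal_gradient g \<Delta>)"
  unfolding principal_gradient_def[abs_def]
  by (intro continuous_intros continuous_monomial_gradient)

lemma toric_principal_gradient:
  "x $ j * principal_gradient g \<Delta> x $ j =
     (\<Sum>\<kappa> | \<kappa> \<in> Poly_Mapping.keys g \<and> real_exponent \<kappa> \<in> \<Delta>.
        Poly_Mapping.lookup g \<kappa> * (real (\<kappa> $ j) * monomial \<kappa> x))"
  by (simp add: principal_gradient_def sum_distrib_left mult.left_commute[of "x $ j"] toric_monomial_gradient)

lemma has_derivative_principal_part_map:
  fixes p :: "'n::finite polynomial ^ 'm::finite"
  shows "(principal_part_map p D has_derivative (\<lambda>h. \<chi> i. principal_gradient (p $ i) (D i) x \<bullet> h)) (at x)"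
proof (subst has_derivative_componentwise_within, intro ballI)
  fix b :: "real ^ 'm" assume "b \<in> Basis"
  then obtain i where b: "b = axis i 1"
    by (auto simp: Basis_vec_def)
  show "((\<lambda>x. principal_part_map p D x \<bullet> b) has_derivative
      (\<lambda>h. (\<chi> i. principal_gradient (p $ i) (D i) x \<bullet> h) \<bullet> b)) (at x)"
    by (simp add: b inner_axis principal_part_map_def has_derivative_principal_part)
qed

lemma toric_jacobian_principal_part_map:
  "toric_jacobian (principal_part_map p D) x $ i $ j =
     x $ j * principal_gradient (p $ i) (D i) x $ j"
  unfolding toric_jacobian_def jacobian_def matrix_def
    frechet_derivative_at[OF has_derivative_principal_part_map, symmetric]
  by (simp add: inner_axis)

subsection \<open>Newton polyhedra\<close>

text \<open>Exponents are nonnegative, so in a convex combination lying on an axis no positively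
  weighted point can leave that axis; a nonzero total forces one of them away from the
  origin.\<close>

lemma convenient_axis_key:
  assumes "convenient g"
  obtains n where "n > 0" and "axis j n \<in> Poly_Mapping.keys g"
proof -
  let ?S = "real_exponent ` Poly_Mapping.keys g \<union> {0}"
  obtain c where c: "c \<noteq> 0" "axis j c \<in> convex hull ?S"
    using assms unfolding convenient_def newton_polyhedron_def by blast
  have "finite ?S" by simp
  then obtain u where u: "\<forall>y\<in>?S. 0 \<le> u y" "(\<Sum>y\<in>?S. u y *\<^sub>R y) = axis j c"
    using c(2) unfolding convex_hull_finite[OF \<open>finite ?S\<close>] by blast
  have comp: "(\<Sum>y\<in>?S. u y * y $ l) = axis j c $ l" for l
    using arg_cong[OF u(2), of "\<lambda>v. v $ l"] by simp
  have nonneg: "0 \<le> u y * y $ l" if "y \<in> ?S" for y l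
    using u(1) that by (auto simp: real_exponent_def)
  obtain y where y: "y \<in> ?S" "u y * y $ j \<noteq> 0"
    using comp[of j] c(1) by (metis (no_types, lifting) axis_nth sum.neutral)
  have zero: "y $ l = 0" if "l \<noteq> j" for l
  proof -
    have "(\<Sum>y\<in>?S. u y * y $ l) = 0"
      using comp[of l] that by (simp add: axis_def)
    then have "u y * y $ l = 0"
      using y(1) nonneg sum_nonneg_eq_0_iff[OF \<open>finite ?S\<close>, of "\<lambda>y. u y * y $ l"] by blast
    then show ?thesis using y(2) by auto
  qed
  obtain \<kappa> where \<kappa>: "\<kappa> \<in> Poly_Mapping.keys g" "y = real_exponent \<kappa>"
    using y by auto
  have "\<kappa> = axis j (\<kappa> $ j)"
    using zero by (auto simp: \<kappa> real_exponent_def axis_def vec_eq_iff)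
  moreover have "\<kappa> $ j > 0"
    using y(2) by (auto simp: \<kappa> real_exponent_def)
  ultimately show ?thesis using \<kappa>(1) that by metis
qed

text \<open>Maxima of a linear functional add up under Minkowski sums, and a sum attains the total
  only if every summand attains its own maximum. The total is positive, so the exposed face misses
  the origin.\<close>

lemma face_at_infinity_of_functional:
  fixes p :: "'n::finite polynomial ^ 'm::finite"
  assumes le: "\<And>i \<kappa>. \<kappa> \<in> Poly_Mapping.keys (p $ i) \<Longrightarrow> q \<bullet> real_exponent \<kappa> \<le> M i"
    and att: "\<And>i. \<exists>\<kappa>\<in>Poly_Mapping.keys (p $ i). q \<bullet> real_exponent \<kappa> = M i"
    and pos: "\<And>i. M i > 0"
    and D: "\<And>i. D i = newton_polyhedron (p $ i) \<inter> {y. q \<bullet> y = M i}"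
  shows "(\<Sum>i\<in>UNIV. D i) \<in> faces_at_infinity p" and "face_decomposition p (\<Sum>i\<in>UNIV. D i) D"
proof -
  have le': "q \<bullet> y \<le> M i" if "y \<in> newton_polyhedron (p $ i)" for y i
  proof -
    \<comment> \<open>Positivity of \<open>M i\<close> covers the generator 0 of the hull.\<close>
    have "newton_polyhedron (p $ i) \<subseteq> {y. q \<bullet> y \<le> M i}"
      unfolding newton_polyhedron_def
      by (rule hull_minimal) (use le pos[of i] in \<open>auto simp: convex_halfspace_le\<close>)
    then show ?thesis using that by blast
  qed
  have convN: "convex (newton_polyhedron (p $ i))" for i
    by (simp add: newton_polyhedron_def)
  have face: "D i face_of newton_polyhedron (p $ i)" for i
    unfolding D by (rule face_of_Int_supporting_hyperplane_le) (use le' convN in auto)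
  then show "face_decomposition p (\<Sum>i\<in>UNIV. D i) D"
    by (simp add: face_decomposition_def)
  have eqD: "(\<Sum>i\<in>UNIV. D i) = newton_polyhedron_map p \<inter> {y. q \<bullet> y = (\<Sum>i\<in>UNIV. M i)}" (is "?L = ?R")
  proof (intro equalityI subsetI)
    fix y assume "y \<in> ?L"
    then obtain s where s: "y = sum s UNIV" "\<And>i. s i \<in> D i"
      by (auto simp: set_sum_alt)
    then have "y \<in> newton_polyhedron_map p"
      by (auto simp: newton_polyhedron_map_def set_sum_alt D)
    moreover have "q \<bullet> y = (\<Sum>i\<in>UNIV. M i)"
      unfolding s(1) inner_sum_right by (rule sum.cong) (use s(2) D in auto)
    ultimately show "y \<in> ?R" by simp
  next
    fix y assume y: "y \<in> ?R"
    then obtain s where s: "y = sum s UNIV" "\<And>i. s i \<in> newton_polyhedron (p $ i)"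
      by (auto simp: newton_polyhedron_map_def set_sum_alt)
    have "(\<Sum>i\<in>UNIV. M i - q \<bullet> s i) = 0"
      using y by (simp add: s(1) inner_sum_right sum_subtractf)
    then have "\<forall>i\<in>UNIV. M i - q \<bullet> s i = 0"
      by (subst (asm) sum_nonneg_eq_0_iff) (use le' s(2) in auto)
    then have "s i \<in> D i" for i
      using s(2) by (simp add: D)
    then show "y \<in> ?L"
      using s(1) by (auto simp: set_sum_alt)
  qed
  have "?L face_of newton_polyhedron_map p"
    unfolding eqD
  proof (rule face_of_Int_supporting_hyperplane_le)
    show "convex (newton_polyhedron_map p)"
      unfolding newton_polyhedron_map_def using convN by (intro convex_set_sum) auto
    fix y assume "y \<in> newton_polyhedron_map p"
    then obtain s where s: "y = sum s UNIV" "\<And>i. s i \<in> newton_polyhedron (p $ i)"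
      by (auto simp: newton_polyhedron_map_def set_sum_alt)
    then show "q \<bullet> y \<le> (\<Sum>i\<in>UNIV. M i)"
      unfolding s(1) inner_sum_right by (intro sum_mono le')
  qed
  moreover have "?L \<noteq> {}"
  proof -
    have "\<exists>y. y \<in> D i" for i
      using att[of i] by (auto simp: D newton_polyhedron_def intro!: hull_inc)
    then obtain s where "\<And>i. s i \<in> D i" by metis
    then have "sum s UNIV \<in> ?L" by (auto simp: set_sum_alt)
    then show ?thesis by blast
  qed
  moreover have "0 \<notin> ?L"
    using sum_pos[of UNIV M] pos by (simp add: eqD)
  ultimately show "?L \<in> faces_at_infinity p"
    by (simp add: faces_at_infinity_def)
qed

subsection \<open>Subsequences\<close>

text \<open>Sequential compactness of the extended reals is applied to one index after another; the
  common lower bound excludes the limit minus infinity.\<close>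

lemma subseq_convergent_or_at_top:
  fixes s :: "'a \<Rightarrow> nat \<Rightarrow> real"
  assumes "finite I" and "\<And>i k. i \<in> I \<Longrightarrow> L \<le> s i k"
  shows "\<exists>r. strict_mono r \<and>
    (\<forall>i\<in>I. convergent (\<lambda>k. s i (r k)) \<or> filterlim (\<lambda>k. s i (r k)) at_top sequentially)"
  using assms
proof (induction I)
  case empty
  then show ?case using strict_mono_id by blast
next
  case (insert a I)
  then obtain r where r: "strict_mono (r :: nat \<Rightarrow> nat)"
    "\<forall>i\<in>I. convergent (\<lambda>k. s i (r k)) \<or> filterlim (\<lambda>k. s i (r k)) at_top sequentially"
    by auto
  obtain l r' where r': "strict_mono (r' :: nat \<Rightarrow> nat)"
    "((\<lambda>k. ereal (s a (r k))) \<circ> r') \<longlonglongrightarrow> l"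
    using compact_complete_linorder by blast
  have lim: "(\<lambda>k. ereal (s a (r (r' k)))) \<longlonglongrightarrow> l"
    using r'(2) by (simp add: o_def)
  have "ereal L \<le> l"
    using insert.prems by (intro LIMSEQ_le_const[OF lim]) auto
  then have "convergent (\<lambda>k. s a (r (r' k))) \<or> filterlim (\<lambda>k. s a (r (r' k))) at_top sequentially"
    using lim by (cases l) (auto simp: convergent_def tendsto_PInfty_eq_at_top)
  moreover have "convergent (\<lambda>k. s i (r (r' k))) \<or> filterlim (\<lambda>k. s i (r (r' k))) at_top sequentially"
    if "i \<in> I" for i
    using r(2) that convergent_subseq_convergent[OF _ r'(1), of "\<lambda>k. s i (r k)"]
      filterlim_compose[OF _ filterlim_subseq[OF r'(1)], of "\<lambda>k. s i (r k)"]
    by (auto simp: o_def)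
  ultimately have "\<forall>i\<in>insert a I. convergent (\<lambda>k. s i ((r \<circ> r') k)) \<or>
      filterlim (\<lambda>k. s i ((r \<circ> r') k)) at_top sequentially"
    by auto
  moreover have "strict_mono (r \<circ> r')"
    using r(1) r'(1) by (rule strict_mono_o)
  ultimately show ?case by blast
qed

lemma subseq_constant:
  assumes "finite (range (s :: nat \<Rightarrow> 'a))"
  obtains r c where "strict_mono (r :: nat \<Rightarrow> nat)" and "\<And>k. s (r k) = c"
proof -
  obtain k0 where "infinite {k \<in> UNIV. s k = s k0}"
    using pigeonhole_infinite[OF infinite_UNIV_nat assms] by blast
  then obtain r where "strict_mono (r :: nat \<Rightarrow> nat)" "\<And>k. r k \<in> {k \<in> UNIV. s k = s k0}"
    using infinite_enumerate by blast
  then show ?thesis using that[of r "s k0"] by auto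
qed

text \<open>\<open>v\<close> is the orthogonal projection of \<open>u\<close> to the span of
  \<open>B\<close>. Self-adjointness turns each of its coordinates into a pairing of
  \<open>u\<close> with a vector of that span, which converges by linearity.\<close>

lemma convergent_plus_orthogonal:
  fixes u :: "nat \<Rightarrow> 'a::euclidean_space"
  assumes "\<And>b. b \<in> B \<Longrightarrow> convergent (\<lambda>k. b \<bullet> u k)"
  obtains v w where "convergent v" and "\<And>k. u k = v k + w k" and "\<And>k b. b \<in> B \<Longrightarrow> b \<bullet> w k = 0"
proof -
  have "\<exists>y z. y \<in> span B \<and> (\<forall>b\<in>span B. orthogonal z b) \<and> x = y + z" for x
    using orthogonal_subspace_decomp_exists[of B x] by metis
  then obtain P Q where P: "\<And>x. P x \<in> span B" and Q: "\<And>x b. b \<in> span B \<Longrightarrow> Q x \<bullet> b = 0"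
    and PQ: "\<And>x. x = P x + Q x"
    unfolding orthogonal_def by metis
  have conv: "convergent (\<lambda>k. b \<bullet> u k)" if "b \<in> span B" for b
    using that
  proof (induction rule: span_induct_alt)
    case base
    then show ?case by (simp add: convergent_const)
  next
    case (step c x y)
    then have "convergent (\<lambda>k. c * (x \<bullet> u k) + y \<bullet> u k)"
      using assms by (intro convergent_add convergent_mult convergent_const) auto
    then show ?case by (simp add: inner_simps)
  qed
  have "P x \<bullet> e = P e \<bullet> x" for x e
  proof -
    have "P x \<bullet> e = P x \<bullet> (P e + Q e)" using PQ by metis
    also have "\<dots> = P x \<bullet> P e" using Q P by (simp add: inner_simps inner_commute)
    also have "\<dots> = (P x + Q x) \<bullet> P e" using Q P by (simp add: inner_simps)
    finally show ?thesis using PQ[of x] by (simp add: inner_commute)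
  qed
  then have "\<exists>l. (\<lambda>k. P (u k) \<bullet> e) \<longlonglongrightarrow> l" for e
    using conv[OF P, of e] by (simp add: convergent_def)
  then obtain l where l: "\<And>e. (\<lambda>k. P (u k) \<bullet> e) \<longlonglongrightarrow> l e" by metis
  have "(\<lambda>k. \<Sum>e\<in>Basis. (P (u k) \<bullet> e) *\<^sub>R e) \<longlonglongrightarrow> (\<Sum>e\<in>Basis. l e *\<^sub>R e)"
    by (intro tendsto_intros l)
  then have "convergent (\<lambda>k. P (u k))"
    by (auto simp: euclidean_representation convergent_def)
  then show ?thesis
    using that[of "\<lambda>k. P (u k)" "\<lambda>k. Q (u k)"] PQ Q by (simp add: span_base inner_commute)
qed

subsection \<open>Pareto solutions from descent directions\<close>

text \<open>As a function of \<open>h\<close>, \<open>f (x + h *\<^sub>R v) + c * h\<close> has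
  negative derivative at 0.\<close>

lemma directional_decrease:
  fixes f :: "'a::real_normed_vector \<Rightarrow> real"
  assumes "(f has_derivative f') (at x)" and "f' v < - c"
  shows "\<forall>\<^sub>F h in at_right 0. f (x + h *\<^sub>R v) \<le> f x - c * h"
proof -
  interpret f': bounded_linear f'
    using assms(1) by (rule has_derivative_bounded_linear)
  have "((\<lambda>h::real. x + h *\<^sub>R v) has_derivative (\<lambda>h. h *\<^sub>R v)) (at 0)"
    by (auto intro!: derivative_eq_intros)
  then have "((\<lambda>h. f (x + h *\<^sub>R v)) has_derivative (\<lambda>h. f' (h *\<^sub>R v))) (at 0)"
    using has_derivative_compose[of "\<lambda>h. x + h *\<^sub>R v" "\<lambda>h. h *\<^sub>R v" 0 UNIV f f'] assms(1) by simp
  then have "((\<lambda>h. f (x + h *\<^sub>R v)) has_real_derivative f' v) (at 0)"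
    by (simp add: has_field_derivative_def f'.scaleR mult.commute[of _ "f' v"])
  then have "((\<lambda>h. f (x + h *\<^sub>R v) + c * h) has_real_derivative (f' v + c)) (at 0)"
    by (auto intro!: derivative_eq_intros)
  from DERIV_neg_dec_right[OF this] assms(2) obtain d where
    "d > 0" "\<And>h. h > 0 \<Longrightarrow> h < d \<Longrightarrow> f (x + h *\<^sub>R v) + c * h < f x"
    by auto
  then show ?thesis
    unfolding eventually_at_right_field by (intro exI[of _ d]) (auto intro: less_imp_le simp: algebra_simps)
qed

text \<open>A point dominating \<open>x\<close> satisfies the constraint as well and has a strictly
  smaller sum of components.\<close>

lemma pareto_solution_if_minimal_sum:
  assumes S: "\<forall>i. f x $ i \<le> t $ i"
    and min: "\<And>y. \<forall>i. f y $ i \<le> t $ i \<Longrightarrow> (\<Sum>i\<in>UNIV. f x $ i) \<le> (\<Sum>i\<in>UNIV. f y $ i)"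
  shows "pareto_solution f x"
  unfolding pareto_solution_def
proof (intro allI notI)
  fix y assume "f y \<in> (\<lambda>v. f x - v) ` (nonneg_orthant - {0})"
  then obtain v where v: "f y = f x - v" "\<forall>i. 0 \<le> v $ i" "v \<noteq> 0"
    by (auto simp: nonneg_orthant_def)
  then obtain j where "v $ j \<noteq> 0" by (auto simp: vec_eq_iff)
  with v have "v $ j > 0" by (metis order_le_less)
  with v have "(\<Sum>i\<in>UNIV. f y $ i) < (\<Sum>i\<in>UNIV. f x $ i)"
    by (intro sum_strict_mono_ex1) auto
  moreover have "f y $ i \<le> t $ i" for i
  proof -
    have "f y $ i \<le> f x $ i" using v by simp
    also have "\<dots> \<le> t $ i" using S by simp
    finally show ?thesis .
  qed
  ultimately show False using min[of y] by simp
qed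

text \<open>The sublevel set may be unbounded, so the sum is first penalised by
  \<open>e * norm x\<close> to make it coercive. Descent directions confine the minimisers to a ball
  independent of \<open>e\<close>; compactness and \<open>e\<close> tending to 0 remove the
  penalty.\<close>

lemma pareto_solution_if_descent:
  fixes f :: "real ^ 'n::finite \<Rightarrow> real ^ 'm::finite"
  assumes deriv: "\<And>i x. ((\<lambda>x. f x $ i) has_derivative (\<lambda>h. g i x \<bullet> h)) (at x)"
    and x0: "\<forall>i. f x0 $ i \<le> t $ i"
    and lower: "\<And>x i. \<forall>i. f x $ i \<le> t $ i \<Longrightarrow> a $ i \<le> f x $ i"
    and c: "c > 0"
    and descent: "\<And>x. \<forall>i. f x $ i \<le> t $ i \<Longrightarrow> R \<le> norm x \<Longrightarrow>
                    \<exists>v. norm v \<le> 1 \<and> (\<forall>i. g i x \<bullet> v \<le> - c)"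
  shows "\<exists>x. pareto_solution f x"
proof -
  define S where "S = {x. \<forall>i. f x $ i \<le> t $ i}"
  define F where "F x = (\<Sum>i\<in>UNIV. f x $ i)" for x
  have contf: "continuous_on UNIV (\<lambda>x. f x $ i)" for i
    by (intro continuous_at_imp_continuous_on ballI has_derivative_continuous[OF deriv])
  have contF: "continuous_on A F" for A
    unfolding F_def[abs_def] by (intro continuous_intros continuous_on_subset[OF contf]) auto
  have "S = (\<Inter>i. {x. f x $ i \<le> t $ i})"
    by (auto simp: S_def)
  then have clS: "closed S"
    by (auto intro!: closed_Collect_le contf continuous_intros)
  have lowF: "(\<Sum>i\<in>UNIV. a $ i) \<le> F x" if "x \<in> S" for x
    unfolding F_def using that lower by (intro sum_mono) (auto simp: S_def)
  have x0S: "x0 \<in> S" using x0 by (simp add: S_def)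
  \<comment> \<open>A minimiser of the penalised sum cannot be far out, since there the descent direction
    decreases \<open>F\<close> faster than the norm can grow.\<close>
  have penal: "\<exists>x\<in>S. norm x \<le> R \<and> (\<forall>y\<in>S. F x + e * norm x \<le> F y + e * norm y)"
    if e: "0 < e" "e < c / 2" for e
  proof -
    \<comment> \<open>Outside this radius the penalty and the lower bound for \<open>F\<close>
      together already reach the penalised value at \<open>x0\<close>.\<close>
    define \<rho> where "\<rho> = (F x0 + e * norm x0 - (\<Sum>i\<in>UNIV. a $ i)) / e"
    have "norm x0 \<le> \<rho>"
      using lowF[OF x0S] e by (simp add: \<rho>_def field_simps)
    then have ne: "S \<inter> cball 0 \<rho> \<noteq> {}" using x0S by auto
    have "compact (S \<inter> cball 0 \<rho>)"
      using clS by (simp add: closed_Int_compact)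
    moreover have "continuous_on (S \<inter> cball 0 \<rho>) (\<lambda>x. F x + e * norm x)"
      by (intro continuous_intros contF)
    ultimately obtain x where x: "x \<in> S \<inter> cball 0 \<rho>"
      "\<And>y. y \<in> S \<inter> cball 0 \<rho> \<Longrightarrow> F x + e * norm x \<le> F y + e * norm y"
      using continuous_attains_inf[of "S \<inter> cball 0 \<rho>" "\<lambda>x. F x + e * norm x"] ne by blast
    have min: "F x + e * norm x \<le> F y + e * norm y" if "y \<in> S" for y
    proof (cases "norm y \<le> \<rho>")
      case True
      then show ?thesis using x(2) that by auto
    next
      case False
      then have "F x0 + e * norm x0 - (\<Sum>i\<in>UNIV. a $ i) \<le> e * norm y"
        using e by (simp add: \<rho>_def field_simps)
      moreover have "F x + e * norm x \<le> F x0 + e * norm x0"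
        using x(2)[of x0] x0S \<open>norm x0 \<le> \<rho>\<close> by auto
      ultimately show ?thesis using lowF[OF that] by linarith
    qed
    have "norm x \<le> R"
    proof (rule ccontr)
      assume "\<not> norm x \<le> R"
      then obtain v where v: "norm v \<le> 1" "\<And>i. g i x \<bullet> v \<le> - c"
        using descent[of x] x(1) by (auto simp: S_def)
      \<comment> \<open>Halving the rate gives the strict inequality that
        \<open>directional_decrease\<close> asks for; \<open>e < c / 2\<close> keeps the penalty
        slower than the decrease.\<close>
      have "\<forall>\<^sub>F h in at_right 0. f (x + h *\<^sub>R v) $ i \<le> f x $ i - c / 2 * h" for i
        by (rule directional_decrease[OF deriv]) (use v(2)[of i] c in linarith)
      then have "\<forall>\<^sub>F h in at_right (0::real). \<forall>i. f (x + h *\<^sub>R v) $ i \<le> f x $ i - c / 2 * h"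
        by (rule eventually_all_finite)
      then have "\<forall>\<^sub>F h in at_right (0::real). (\<forall>i. f (x + h *\<^sub>R v) $ i \<le> f x $ i - c / 2 * h) \<and> 0 < h"
        by (rule eventually_conj[OF _ eventually_at_right_less])
      from eventually_happens'[OF trivial_limit_at_right_real this]
      obtain h :: real where h: "h > 0" "\<And>i. f (x + h *\<^sub>R v) $ i \<le> f x $ i - c / 2 * h"
        by blast
      have "f (x + h *\<^sub>R v) $ i \<le> t $ i" for i
      proof -
        have "f x $ i \<le> t $ i" using x(1) by (simp add: S_def)
        then show ?thesis using h(2)[of i] mult_pos_pos[of "c/2" h] c h(1) by linarith
      qed
      then have "x + h *\<^sub>R v \<in> S"
        by (simp add: S_def)
      then have "F x + e * norm x \<le> F (x + h *\<^sub>R v) + e * norm (x + h *\<^sub>R v)"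
        by (rule min)
      also have "F (x + h *\<^sub>R v) \<le> (\<Sum>i\<in>UNIV. f x $ i - c / 2 * h)"
        unfolding F_def by (intro sum_mono h(2))
      also have "\<dots> = F x - real CARD('m) * (c / 2 * h)"
        by (simp add: F_def sum_subtractf)
      also have "\<dots> \<le> F x - 1 * (c / 2 * h)"
        using c h(1) by (intro diff_left_mono mult_right_mono) (auto simp: Suc_le_eq)
      also have "norm (x + h *\<^sub>R v) \<le> norm x + h * norm v"
        using norm_triangle_ineq[of x "h *\<^sub>R v"] h(1) by simp
      also have "h * norm v \<le> h * 1"
        using v(1) h(1) by (intro mult_left_mono) auto
      finally have "c / 2 * h \<le> e * h"
        using e(1) by (simp add: algebra_simps)
      then show False using e h(1) by (simp add: mult_le_cancel_right)
    qed
    then show ?thesis using x(1) min by auto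
  qed
  have "\<exists>x\<in>S. norm x \<le> R"
    using penal[of "c / 4"] c by auto
  then have ne: "S \<inter> cball 0 R \<noteq> {}"
    by auto
  have "compact (S \<inter> cball 0 R)"
    using clS by (simp add: closed_Int_compact)
  from continuous_attains_inf[OF this ne contF]
  obtain x where x: "x \<in> S \<inter> cball 0 R" "\<And>y. y \<in> S \<inter> cball 0 R \<Longrightarrow> F x \<le> F y"
    by blast
  \<comment> \<open>Comparison with the penalised minimiser \<open>x'\<close> in the ball gives
    \<open>F x \<le> F x' \<le> F y + e * norm y\<close>; then \<open>e\<close> tends to 0.\<close>
  have "F x \<le> F y" if "y \<in> S" for y
  proof (rule tendsto_lowerbound)
    show "((\<lambda>e. F y + e * norm y) \<longlongrightarrow> F y) (at_right 0)"
      by (auto intro!: tendsto_eq_intros)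
    have "F x \<le> F y + e * norm y" if e: "0 < e" "e < c / 2" for e
    proof -
      obtain x' where x': "x' \<in> S" "norm x' \<le> R" "F x' + e * norm x' \<le> F y + e * norm y"
        using penal[OF e] \<open>y \<in> S\<close> by blast
      then have "F x \<le> F x'" using x(2) by simp
      moreover have "0 \<le> e * norm x'" using e by simp
      ultimately show ?thesis using x'(3) by linarith
    qed
    then show "\<forall>\<^sub>F e in at_right 0. F x \<le> F y + e * norm y"
      unfolding eventually_at_right_field using c by (intro exI[of _ "c / 2"]) auto
  qed simp
  then have "pareto_solution f x"
    using x(1) by (intro pareto_solution_if_minimal_sum[of f x t]) (auto simp: S_def F_def)
  then show ?thesis ..
qed

subsection \<open>Descent directions at infinity\<close>

text \<open>Nonzero coordinates make the logarithms available. The passage to a subsequence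
  stabilises the combinatorial data that determine the face.\<close>

lemma descent_along_sequence:
  fixes p :: "'n::finite polynomial ^ 'm::finite" and x :: "nat \<Rightarrow> real ^ 'n"
  assumes conv: "convenient_map p" and khov: "khovanskii_nondegenerate p"
    and nz: "\<And>k j. x k $ j \<noteq> 0"
    and inf: "filterlim (\<lambda>k. norm (x k)) at_top sequentially"
    and bdd: "\<And>k i. \<bar>poly_map p (x k) $ i\<bar> \<le> M"
  obtains r c where "strict_mono (r :: nat \<Rightarrow> nat)" and "c > 0"
    and "\<forall>\<^sub>F k in sequentially. \<exists>v. norm v \<le> 1 \<and> (\<forall>i. principal_gradient (p $ i) UNIV (x (r k)) \<bullet> v \<le> - c)"
proof -
  \<comment> \<open>The exponent 0 is inserted as in the Newton polyhedron; it makes the maximal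
    pairing with \<open>u k\<close> nonnegative.\<close>
  define K where "K i = insert 0 (Poly_Mapping.keys (p $ i))" for i
  define u where "u k = (\<chi> j. ln \<bar>x k $ j\<bar>)" for k
  have finK: "finite (K i)" for i by (simp add: K_def)
  have re0 [simp]: "real_exponent 0 = 0" by (simp add: real_exponent_def vec_eq_iff)

  \<comment> \<open>Stabilising dominant exponents, signs and gaps\<close>
  have "\<exists>\<kappa>\<in>K i. \<forall>\<kappa>'\<in>K i. real_exponent \<kappa>' \<bullet> u k \<le> real_exponent \<kappa> \<bullet> u k" for i k
    using ex_is_arg_min_if_finite[OF finK, of i "\<lambda>\<kappa>. - (real_exponent \<kappa> \<bullet> u k)"]
    by (auto simp: is_arg_min_linorder K_def)
  then have "\<forall>k i. \<exists>\<kappa>. \<kappa> \<in> K i \<and> (\<forall>\<kappa>'\<in>K i. real_exponent \<kappa>' \<bullet> u k \<le> real_exponent \<kappa> \<bullet> u k)"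
    by blast
  then obtain m where m: "\<And>k i. m k i \<in> K i"
    "\<And>k i \<kappa>. \<kappa> \<in> K i \<Longrightarrow> real_exponent \<kappa> \<bullet> u k \<le> real_exponent (m k i) \<bullet> u k"
    unfolding choice_iff by blast
  \<comment> \<open>Signs are recorded along with the maximisers because the logarithms forget
    them.\<close>
  have "range (\<lambda>k. (m k, \<lambda>j. sgn (x k $ j))) \<subseteq> PiE UNIV K \<times> PiE UNIV (\<lambda>_. {-1, 1})"
    using m(1) nz by (auto simp: sgn_if split: if_splits)
  moreover have "finite (PiE UNIV K \<times> (PiE UNIV (\<lambda>_. {-1, 1}) :: ('n \<Rightarrow> real) set))"
    using finK by (intro finite_cartesian_product finite_PiE) auto
  ultimately have "finite (range (\<lambda>k. (m k, \<lambda>j. sgn (x k $ j))))"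
    by (rule finite_subset)
  from subseq_constant[OF this] obtain r0 c0 where r0: "strict_mono (r0 :: nat \<Rightarrow> nat)"
    "\<And>k. (m (r0 k), \<lambda>j. sgn (x (r0 k) $ j)) = c0"
    by blast
  define \<mu> where "\<mu> = fst c0"
  define \<sigma> where "\<sigma> = snd c0"
  have m_r0: "m (r0 k) = \<mu>" and sgn_r0: "sgn (x (r0 k) $ j) = \<sigma> j" for k j
    using r0(2)[of k] by (auto simp: \<mu>_def \<sigma>_def)
  have \<mu>K: "\<mu> i \<in> K i" for i
    using m(1)[of "r0 0" i] m_r0 by simp
  define gap where "gap i \<kappa> = real_exponent (\<mu> i) - real_exponent \<kappa>" for i \<kappa>
  have gap_nonneg: "0 \<le> gap i \<kappa> \<bullet> u (r0 k)" if "\<kappa> \<in> K i" for i \<kappa> k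
    using m(2)[OF that, of "r0 k"] by (simp add: gap_def m_r0 inner_simps)
  \<comment> \<open>Maximality makes all gaps nonnegative, so 0 serves as the lower bound in the
    simultaneous extraction.\<close>
  have "finite (Sigma UNIV K)" using finK by simp
  from subseq_convergent_or_at_top[OF this, of 0 "\<lambda>(i, \<kappa>) k. gap i \<kappa> \<bullet> u (r0 k)"] gap_nonneg
  obtain r1 where r1: "strict_mono (r1 :: nat \<Rightarrow> nat)"
    "\<And>i \<kappa>. \<kappa> \<in> K i \<Longrightarrow> convergent (\<lambda>k. gap i \<kappa> \<bullet> u (r0 (r1 k))) \<or>
       filterlim (\<lambda>k. gap i \<kappa> \<bullet> u (r0 (r1 k))) at_top sequentially"
    by auto
  define r where "r = r0 \<circ> r1"
  define X where "X k = x (r k)" for k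
  define U where "U k = u (r k)" for k
  have r: "strict_mono r"
    using r0(1) r1(1) by (simp add: r_def strict_mono_o)
  have infX: "filterlim (\<lambda>k. norm (X k)) at_top sequentially"
    unfolding X_def by (rule filterlim_compose[OF inf filterlim_subseq[OF r]])
  then have X_pos: "\<forall>\<^sub>F k in sequentially. 0 < norm (X k)"
    unfolding filterlim_at_top_dense by blast
  have X_eq: "X k $ j = \<sigma> j * exp (U k $ j)" for k j
    using nz[of "r k" j] by (simp add: X_def U_def u_def r_def sgn_r0[of "r1 k" j, symmetric] sgn_mult_abs)
  have \<sigma>: "\<bar>\<sigma> j\<bar> = 1" for j
    using sgn_r0[of 0 j] nz[of "r0 0" j] by (auto simp: sgn_if split: if_splits)
  have U_max: "real_exponent \<kappa> \<bullet> U k \<le> real_exponent (\<mu> i) \<bullet> U k" if "\<kappa> \<in> K i" for i \<kappa> k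
    using gap_nonneg[OF that, of "r1 k"] by (simp add: gap_def U_def r_def inner_simps)

  \<comment> \<open>Growth of the dominant monomials\<close>
  define A where "A i = {\<kappa> \<in> K i. convergent (\<lambda>k. gap i \<kappa> \<bullet> U k)}" for i
  have notA: "filterlim (\<lambda>k. gap i \<kappa> \<bullet> U k) at_top sequentially" if "\<kappa> \<in> K i" "\<kappa> \<notin> A i" for i \<kappa>
    using that r1(2)[of \<kappa> i] by (auto simp: A_def U_def r_def)
  have \<mu>A: "\<mu> i \<in> A i" for i
    using \<mu>K by (simp add: A_def gap_def convergent_const)

  \<comment> \<open>By convenience some \<open>axis j n\<close> with \<open>n > 0\<close> competes
    with \<open>\<mu> i\<close> for each \<open>j\<close>, and so does the exponent 0; hence
    \<open>U k $ j\<close> is at most the maximum, whatever its sign.\<close>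
  have exp_ge: "norm (X k) / real CARD('n) \<le> exp (real_exponent (\<mu> i) \<bullet> U k)" for i k
  proof -
    define P where "P = real_exponent (\<mu> i) \<bullet> U k"
    have "P \<ge> 0"
      using U_max[of 0 i k] by (simp add: P_def K_def)
    have "\<bar>X k $ j\<bar> \<le> exp P" for j
    proof -
      have "convenient (p $ i)" using conv by (simp add: convenient_map_def)
      then obtain n where n: "n > 0" "axis j n \<in> Poly_Mapping.keys (p $ i)"
        using convenient_axis_key by blast
      have "real_exponent (axis j n) = axis j (real n)"
        by (simp add: real_exponent_def axis_def vec_eq_iff)
      then have "real n * U k $ j \<le> P"
        using U_max[of "axis j n" i k] n(2) by (simp add: P_def K_def inner_axis')
      moreover have "U k $ j \<le> real n * U k $ j" if "U k $ j \<ge> 0"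
        using mult_right_mono[of 1 "real n" "U k $ j"] n(1) that by simp
      ultimately have "U k $ j \<le> P"
        using \<open>P \<ge> 0\<close> by linarith
      then show ?thesis by (simp add: X_eq abs_mult \<sigma>)
    qed
    then have "norm (X k) \<le> (\<Sum>j\<in>(UNIV :: 'n set). exp P)"
      using norm_le_l1_cart[of "X k"] sum_mono[of UNIV "\<lambda>j. \<bar>X k $ j\<bar>" "\<lambda>_. exp P"] by fastforce
    then show ?thesis by (simp add: P_def field_simps)
  qed
  have P_top: "filterlim (\<lambda>k. real_exponent (\<mu> i) \<bullet> U k) at_top sequentially" for i
  proof (rule filterlim_at_top_mono)
    have "filterlim (\<lambda>k. 1 / real CARD('n) * norm (X k)) at_top sequentially"
      by (rule filterlim_tendsto_pos_mult_at_top[OF tendsto_const _ infX]) simp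
    then show "filterlim (\<lambda>k. ln (1 / real CARD('n) * norm (X k))) at_top sequentially"
      by (rule filterlim_compose[OF ln_at_top])
    show "\<forall>\<^sub>F k in sequentially. ln (1 / real CARD('n) * norm (X k)) \<le> real_exponent (\<mu> i) \<bullet> U k"
      using X_pos
    proof eventually_elim
      case (elim k)
      then have "ln (1 / real CARD('n) * norm (X k)) \<le> ln (exp (real_exponent (\<mu> i) \<bullet> U k))"
        using exp_ge[of k i] by (intro ln_mono) auto
      then show ?case by simp
    qed
  qed
  \<comment> \<open>Otherwise the pairing of \<open>\<mu> i\<close> itself would converge. So
    \<open>\<mu> i\<close> is a true exponent of the polynomial and not the inserted 0.\<close>
  have zeroA: "0 \<notin> A i" for i
  proof
    assume "0 \<in> A i"
    then obtain l where "(\<lambda>k. real_exponent (\<mu> i) \<bullet> U k) \<longlonglongrightarrow> l"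
      by (auto simp: A_def gap_def convergent_def)
    then show False
      using not_tendsto_and_filterlim_at_infinity[OF _ _ filterlim_at_top_imp_at_infinity[OF P_top[of i]]]
      by simp
  qed

  \<comment> \<open>Splitting the logarithms and exposing a face\<close>
  have "convergent (\<lambda>k. b \<bullet> U k)" if "b \<in> (\<Union>i. gap i ` A i)" for b
    using that by (auto simp: A_def)
  from convergent_plus_orthogonal[of "\<Union>i. gap i ` A i" U, OF this]
  obtain v w where "convergent v" and vw: "\<And>k. U k = v k + w k"
    and w: "\<And>k b. b \<in> (\<Union>i. gap i ` A i) \<Longrightarrow> b \<bullet> w k = 0"
    by blast
  then obtain vl where vl: "v \<longlonglongrightarrow> vl" by (auto simp: convergent_def)
  have w_eq: "w k = U k - v k" for k using vw[of k] by simp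
  have w_zero: "gap i \<kappa> \<bullet> w k = 0" if "\<kappa> \<in> A i" for i \<kappa> k
    using w that by blast
  have minus_v_top: "filterlim (\<lambda>k. b \<bullet> w k) at_top sequentially"
    if "filterlim (\<lambda>k. b \<bullet> U k) at_top sequentially" for b
  proof -
    have "(\<lambda>k. - (b \<bullet> v k)) \<longlonglongrightarrow> - (b \<bullet> vl)"
      by (intro tendsto_intros vl)
    from filterlim_tendsto_add_at_top[OF this that] show ?thesis
      by (simp add: w_eq inner_simps)
  qed
  have w_top: "filterlim (\<lambda>k. gap i \<kappa> \<bullet> w k) at_top sequentially" if "\<kappa> \<in> K i" "\<kappa> \<notin> A i" for i \<kappa>
    using notA[OF that] by (rule minus_v_top)
  have \<mu>w_top: "filterlim (\<lambda>k. real_exponent (\<mu> i) \<bullet> w k) at_top sequentially" for i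
    using P_top by (rule minus_v_top)

  \<comment> \<open>Finitely many strict inequalities hold jointly from some index on, so a single
    vector \<open>w k0\<close> serves all components.\<close>
  have "\<forall>\<^sub>F k in sequentially. \<forall>\<kappa>\<in>K i - A i. 0 < gap i \<kappa> \<bullet> w k" for i
    using finK w_top by (intro eventually_ball_finite) (auto simp: filterlim_at_top_dense)
  moreover have "\<forall>\<^sub>F k in sequentially. 0 < real_exponent (\<mu> i) \<bullet> w k" for i
    using \<mu>w_top unfolding filterlim_at_top_dense by blast
  ultimately have "\<forall>\<^sub>F k in sequentially. \<forall>i. (\<forall>\<kappa>\<in>K i - A i. 0 < gap i \<kappa> \<bullet> w k) \<and> 0 < real_exponent (\<mu> i) \<bullet> w k"
    by (intro eventually_all_finite eventually_conj)
  then obtain k0 where k0: "\<And>i \<kappa>. \<kappa> \<in> K i - A i \<Longrightarrow> 0 < gap i \<kappa> \<bullet> w k0"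
    "\<And>i. 0 < real_exponent (\<mu> i) \<bullet> w k0"
    using eventually_happens'[OF sequentially_bot] by blast
  define q where "q = w k0"
  define D where "D i = newton_polyhedron (p $ i) \<inter> {y. q \<bullet> y = q \<bullet> real_exponent (\<mu> i)}" for i
  have \<mu>key: "\<mu> i \<in> Poly_Mapping.keys (p $ i)" for i
    using \<mu>A[of i] zeroA[of i] \<mu>K[of i] by (auto simp: K_def)
  \<comment> \<open>Gaps of exponents in \<open>A i\<close> are orthogonal to \<open>q\<close>, all
    others pair positively with it.\<close>
  have keyD: "real_exponent \<kappa> \<in> D i \<longleftrightarrow> \<kappa> \<in> A i" if "\<kappa> \<in> Poly_Mapping.keys (p $ i)" for i \<kappa>
  proof -
    have "real_exponent \<kappa> \<in> newton_polyhedron (p $ i)"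
      using that by (auto simp: newton_polyhedron_def intro!: hull_inc)
    moreover have "\<kappa> \<in> K i" using that by (simp add: K_def)
    moreover have "gap i \<kappa> \<bullet> q = q \<bullet> real_exponent (\<mu> i) - q \<bullet> real_exponent \<kappa>"
      by (simp add: gap_def inner_simps inner_commute)
    ultimately show ?thesis
      using w_zero[of \<kappa> i k0] k0(1)[of \<kappa> i] by (cases "\<kappa> \<in> A i") (auto simp: D_def q_def)
  qed
  have face: "(\<Sum>i\<in>UNIV. D i) \<in> faces_at_infinity p" "face_decomposition p (\<Sum>i\<in>UNIV. D i) D"
  proof -
    have le: "q \<bullet> real_exponent \<kappa> \<le> q \<bullet> real_exponent (\<mu> i)" if "\<kappa> \<in> Poly_Mapping.keys (p $ i)" for i \<kappa>
    proof -
      have "0 \<le> gap i \<kappa> \<bullet> q"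
        using w_zero[of \<kappa> i k0] k0(1)[of \<kappa> i] that by (cases "\<kappa> \<in> A i") (auto simp: q_def K_def)
      then show ?thesis by (simp add: gap_def inner_simps inner_commute)
    qed
    have pos: "0 < q \<bullet> real_exponent (\<mu> i)" for i
      using k0(2)[of i] by (simp add: q_def inner_commute)
    show "(\<Sum>i\<in>UNIV. D i) \<in> faces_at_infinity p" "face_decomposition p (\<Sum>i\<in>UNIV. D i) D"
      by (rule face_at_infinity_of_functional[OF le _ pos D_def]; use \<mu>key in blast)+
  qed

  \<comment> \<open>Rescaled limits on the torus\<close>
  define z where "z k = (\<chi> j. \<sigma> j * exp (v k $ j))" for k
  define zl where "zl = (\<chi> j. \<sigma> j * exp (vl $ j))"
  have z: "z \<longlonglongrightarrow> zl"
    unfolding z_def zl_def by (intro tendsto_vec_lambda tendsto_intros vl)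
  have zl_nz: "zl $ j \<noteq> 0" for j
    using \<sigma>[of j] by (auto simp: zl_def)
  define s where "s i k = exp (real_exponent (\<mu> i) \<bullet> w k)" for i k
  have s_pos: "s i k > 0" for i k by (simp add: s_def)
  have mono_X: "monomial \<kappa> (X k) = monomial \<kappa> (z k) * exp (real_exponent \<kappa> \<bullet> w k)" for \<kappa> k
    by (rule monomial_exp_scale) (simp add: X_eq z_def vw exp_add)
  \<comment> \<open>After division by \<open>s i k\<close>, the term of \<open>\<kappa>\<close>
    carries the factor \<open>exp (- (gap i \<kappa> \<bullet> w k))\<close>, which is 1 on
    \<open>A i\<close> and tends to 0 off it. The free coefficients \<open>b\<close> cover both
    values and toric derivatives.\<close>
  have lim: "(\<lambda>k. (\<Sum>\<kappa>\<in>Poly_Mapping.keys (p $ i). b \<kappa> * monomial \<kappa> (X k)) / s i k) \<longlonglongrightarrow>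
      (\<Sum>\<kappa> | \<kappa> \<in> Poly_Mapping.keys (p $ i) \<and> real_exponent \<kappa> \<in> D i. b \<kappa> * monomial \<kappa> zl)" for i b
  proof -
    have summand: "(\<lambda>k. b \<kappa> * monomial \<kappa> (z k) * exp (- (gap i \<kappa> \<bullet> w k))) \<longlonglongrightarrow>
        (if real_exponent \<kappa> \<in> D i then b \<kappa> * monomial \<kappa> zl else 0)"
      if \<kappa>: "\<kappa> \<in> Poly_Mapping.keys (p $ i)" for \<kappa>
    proof -
      have "(\<lambda>k. exp (- (gap i \<kappa> \<bullet> w k))) \<longlonglongrightarrow> (if \<kappa> \<in> A i then 1 else 0)"
      proof (cases "\<kappa> \<in> A i")
        case False
        have "filterlim (\<lambda>k. - (gap i \<kappa> \<bullet> w k)) at_bot sequentially"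
          using w_top[of \<kappa> i] \<kappa> False by (simp add: K_def filterlim_uminus_at_bot)
        from filterlim_compose[OF exp_at_bot this] False show ?thesis by simp
      qed (simp add: w_zero)
      then have "(\<lambda>k. b \<kappa> * monomial \<kappa> (z k) * exp (- (gap i \<kappa> \<bullet> w k))) \<longlonglongrightarrow>
          b \<kappa> * monomial \<kappa> zl * (if \<kappa> \<in> A i then 1 else 0)"
        by (intro tendsto_mult tendsto_const tendsto_monomial z)
      then show ?thesis using keyD[OF \<kappa>] by (simp split: if_splits)
    qed
    have "(\<Sum>\<kappa>\<in>Poly_Mapping.keys (p $ i). b \<kappa> * monomial \<kappa> (X k)) / s i k =
        (\<Sum>\<kappa>\<in>Poly_Mapping.keys (p $ i). b \<kappa> * monomial \<kappa> (z k) * exp (- (gap i \<kappa> \<bullet> w k)))" for k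
      unfolding sum_divide_distrib
      by (intro sum.cong refl) (simp add: mono_X s_def gap_def inner_diff_left exp_diff)
    moreover have "(\<Sum>\<kappa>\<in>Poly_Mapping.keys (p $ i). if real_exponent \<kappa> \<in> D i then b \<kappa> * monomial \<kappa> zl else 0) =
        (\<Sum>\<kappa> | \<kappa> \<in> Poly_Mapping.keys (p $ i) \<and> real_exponent \<kappa> \<in> D i. b \<kappa> * monomial \<kappa> zl)"
      by (simp add: sum.inter_filter)
    moreover have "(\<lambda>k. \<Sum>\<kappa>\<in>Poly_Mapping.keys (p $ i). b \<kappa> * monomial \<kappa> (z k) * exp (- (gap i \<kappa> \<bullet> w k))) \<longlonglongrightarrow>
        (\<Sum>\<kappa>\<in>Poly_Mapping.keys (p $ i). if real_exponent \<kappa> \<in> D i then b \<kappa> * monomial \<kappa> zl else 0)"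
      by (intro tendsto_sum summand)
    ultimately show ?thesis by simp
  qed

  \<comment> \<open>Non-degeneracy and the descent direction\<close>
  have "principal_part_map p D zl = 0"
  proof -
    \<comment> \<open>The numerators stay bounded while \<open>s i k\<close> tends to infinity, so
      the rescaled values also tend to 0.\<close>
    have "principal_part (p $ i) (D i) zl = 0" for i
    proof (rule LIMSEQ_unique)
      show "(\<lambda>k. poly_fun (p $ i) (X k) / s i k) \<longlonglongrightarrow> principal_part (p $ i) (D i) zl"
        unfolding poly_fun_def principal_part_def by (rule lim)
      have s_top: "filterlim (s i) at_top sequentially"
        unfolding s_def by (rule filterlim_compose[OF exp_at_top \<mu>w_top])
      have "norm (poly_fun (p $ i) (X k) / s i k) \<le> M / s i k" for k
        using bdd[of "r k" i] s_pos[of i k] by (simp add: poly_map_def X_def divide_right_mono)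
      then have "\<forall>\<^sub>F k in sequentially. norm (poly_fun (p $ i) (X k) / s i k) \<le> M / s i k"
        by simp
      moreover have "(\<lambda>k. M / s i k) \<longlonglongrightarrow> 0"
        by (rule real_tendsto_divide_at_top[OF tendsto_const s_top])
      ultimately show "(\<lambda>k. poly_fun (p $ i) (X k) / s i k) \<longlonglongrightarrow> 0"
        by (rule Lim_null_comparison)
    qed
    then show ?thesis by (simp add: principal_part_map_def vec_eq_iff)
  qed
  then have "rank (toric_jacobian (principal_part_map p D) zl) = CARD('m)"
    using khov face zl_nz unfolding khovanskii_nondegenerate_def by blast
  then have "surj ((*v) (toric_jacobian (principal_part_map p D) zl))"
    by (simp only: full_rank_surjective)
  \<comment> \<open>\<open>1\<close> is the all-ones vector: to first order all components grow
    together along \<open>y\<close>.\<close>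
  then obtain y where y: "toric_jacobian (principal_part_map p D) zl *v y = 1"
    by (metis surjD)
  then have "y \<noteq> 0" by auto
  \<comment> \<open>The chart \<open>h \<mapsto> (x\<^sub>j h\<^sub>j)\<^sub>j\<close> turns the toric derivative into the ordinary one.\<close>
  define d where "d k = (\<chi> j. X k $ j * y $ j)" for k
  have lim1: "(\<lambda>k. (principal_gradient (p $ i) UNIV (X k) \<bullet> d k) / s i k) \<longlonglongrightarrow> 1" for i
  proof -
    have "(\<lambda>k. (X k $ j * principal_gradient (p $ i) UNIV (X k) $ j) / s i k) \<longlonglongrightarrow>
        zl $ j * principal_gradient (p $ i) (D i) zl $ j" for j
      using lim[of "\<lambda>\<kappa>. Poly_Mapping.lookup (p $ i) \<kappa> * real (\<kappa> $ j)" i]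
      by (simp add: toric_principal_gradient mult.assoc)
    then have "(\<lambda>k. \<Sum>j\<in>UNIV. (X k $ j * principal_gradient (p $ i) UNIV (X k) $ j) / s i k * y $ j) \<longlonglongrightarrow>
        (\<Sum>j\<in>UNIV. zl $ j * principal_gradient (p $ i) (D i) zl $ j * y $ j)"
      by (intro tendsto_intros)
    moreover have "(\<Sum>j\<in>UNIV. zl $ j * principal_gradient (p $ i) (D i) zl $ j * y $ j) = 1"
      using arg_cong[OF y, of "\<lambda>a. a $ i"]
      by (simp add: matrix_vector_mult_def toric_jacobian_principal_part_map)
    ultimately show ?thesis
      by (simp add: d_def inner_vec_def sum_divide_distrib mult_ac)
  qed
  have s_ge: "\<exists>c>0. \<forall>\<^sub>F k in sequentially. c * norm (X k) \<le> s i k" for i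
  proof -
    \<comment> \<open>\<open>s i k\<close> is
      \<open>exp (real_exponent (\<mu> i) \<bullet> U k)\<close> times a factor controlled by the
      convergent \<open>v\<close>; the summand 1 is slack above the limit.\<close>
    define E where "E = exp (- (real_exponent (\<mu> i) \<bullet> vl + 1)) / real CARD('n)"
    have "(\<lambda>k. real_exponent (\<mu> i) \<bullet> v k) \<longlonglongrightarrow> real_exponent (\<mu> i) \<bullet> vl"
      by (intro tendsto_intros vl)
    then have "\<forall>\<^sub>F k in sequentially. real_exponent (\<mu> i) \<bullet> v k < real_exponent (\<mu> i) \<bullet> vl + 1"
      by (rule order_tendstoD) simp
    then have "\<forall>\<^sub>F k in sequentially. E * norm (X k) \<le> s i k"
    proof eventually_elim
      case (elim k)
      have "E * norm (X k) = norm (X k) / real CARD('n) * exp (- (real_exponent (\<mu> i) \<bullet> vl + 1))"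
        by (simp add: E_def)
      also have "\<dots> \<le> exp (real_exponent (\<mu> i) \<bullet> U k) * exp (- (real_exponent (\<mu> i) \<bullet> v k))"
        using elim by (intro mult_mono exp_ge) auto
      also have "\<dots> = s i k"
        by (simp add: s_def w_eq inner_simps exp_diff exp_minus field_simps)
      finally show ?case .
    qed
    moreover have "E > 0" by (simp add: E_def)
    ultimately show ?thesis by blast
  qed
  then obtain c1 where c1: "\<And>i. c1 i > 0" "\<And>i. \<forall>\<^sub>F k in sequentially. c1 i * norm (X k) \<le> s i k"
    by metis
  \<comment> \<open>The factor 2 comes from the threshold \<open>1 / 2\<close> below the limit 1,
    \<open>norm y\<close> from normalising \<open>d k\<close>, and the minimum makes the rate common
    to all components.\<close>
  define c where "c = Min (range c1) / (2 * norm y)"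
  have Min: "Min (range c1) > 0" "Min (range c1) \<le> c1 i" for i
    using c1(1) by auto
  have "c > 0"
    using Min(1) \<open>y \<noteq> 0\<close> by (simp add: c_def)
  have "\<forall>\<^sub>F k in sequentially. 1 / 2 < (principal_gradient (p $ i) UNIV (X k) \<bullet> d k) / s i k" for i
    using lim1[of i] by (rule order_tendstoD) simp
  then have "\<forall>\<^sub>F k in sequentially. \<forall>i. 1 / 2 < (principal_gradient (p $ i) UNIV (X k) \<bullet> d k) / s i k"
    by (rule eventually_all_finite)
  moreover have "\<forall>\<^sub>F k in sequentially. \<forall>i. c1 i * norm (X k) \<le> s i k"
    using c1(2) by (rule eventually_all_finite)
  moreover note X_pos
  ultimately have "\<forall>\<^sub>F k in sequentially. \<exists>v. norm v \<le> 1 \<and>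
      (\<forall>i. principal_gradient (p $ i) UNIV (X k) \<bullet> v \<le> - c)"
  proof eventually_elim
    case (elim k)
    define N where "N = norm (X k) * norm y"
    have N: "N > 0" using elim(3) \<open>y \<noteq> 0\<close> by (simp add: N_def)
    have "norm (d k) \<le> norm (norm (X k) *\<^sub>R y)"
      by (rule norm_le_componentwise_cart)
        (auto simp: d_def abs_mult intro!: mult_right_mono component_le_norm_cart)
    then have "norm (d k) \<le> N" by (simp add: N_def)
    then have "norm (- (1 / N) *\<^sub>R d k) \<le> 1"
      using N by (simp add: field_simps)
    moreover have "principal_gradient (p $ i) UNIV (X k) \<bullet> (- (1 / N) *\<^sub>R d k) \<le> - c" for i
    proof -
      have "c * N = 1 / 2 * (Min (range c1) * norm (X k))"
        using \<open>y \<noteq> 0\<close> by (simp add: c_def N_def)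
      also have "\<dots> \<le> 1 / 2 * (c1 i * norm (X k))"
        using Min(2)[of i] by (intro mult_left_mono mult_right_mono) auto
      also have "\<dots> \<le> 1 / 2 * s i k"
        using elim(2) by simp
      also have "\<dots> \<le> principal_gradient (p $ i) UNIV (X k) \<bullet> d k"
        using elim(1)[rule_format, of i] s_pos[of i k] by (simp add: field_simps)
      finally show ?thesis using N by (simp add: field_simps)
    qed
    ultimately show ?case by blast
  qed
  then show ?thesis
    using that[OF r \<open>c > 0\<close>] by (simp add: X_def)
qed

text \<open>Without a uniform rate there would be points tending to infinity whose rates tend to 0;
  moved off the coordinate hyperplanes, they contradict
  \<open>descent_along_sequence\<close>.\<close>

lemma descent_at_infinity:
  fixes p :: "'n::finite polynomial ^ 'm::finite"
  assumes conv: "convenient_map p" and khov: "khovanskii_nondegenerate p"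
  shows "\<exists>R c. c > 0 \<and> (\<forall>x. (\<forall>i. \<bar>poly_map p x $ i\<bar> \<le> M) \<longrightarrow> R \<le> norm x \<longrightarrow>
           (\<exists>v. norm v \<le> 1 \<and> (\<forall>i. principal_gradient (p $ i) UNIV x \<bullet> v \<le> - c)))"
proof (rule ccontr)
  let ?g = "\<lambda>i. principal_gradient (p $ i) UNIV"
  let ?bad = "\<lambda>e x. \<forall>v. norm v \<le> 1 \<longrightarrow> (\<exists>i. ?g i x \<bullet> v > - e)"
  assume "\<not> ?thesis"
  then have neg: "\<And>R c. c > 0 \<Longrightarrow> \<exists>x. (\<forall>i. \<bar>poly_map p x $ i\<bar> \<le> M) \<and> R \<le> norm x \<and> ?bad c x"
    by (meson not_le)
  \<comment> \<open>The perturbation is paid for by \<open>M + 1\<close> in place of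
    \<open>M\<close> and by doubling the rate \<open>1 / real (Suc k)\<close>.\<close>
  have "\<exists>y. (\<forall>j. y $ j \<noteq> 0) \<and> real k < norm y \<and> (\<forall>i. \<bar>poly_map p y $ i\<bar> \<le> M + 1) \<and>
      ?bad (2 / real (Suc k)) y" for k
  proof -
    define e where "e = 1 / real (Suc k)"
    have "e > 0" by (simp add: e_def)
    from neg[OF this, of "real k + 1"] obtain x where
      x: "\<And>i. \<bar>poly_map p x $ i\<bar> \<le> M" "real k + 1 \<le> norm x" "?bad e x"
      by blast
    \<comment> \<open>\<open>1\<close> is the all-ones vector; a small positive \<open>h\<close>
      makes zero coordinates positive and keeps the others nonzero.\<close>
    define Y where "Y h = x + h *\<^sub>R 1" for h :: real
    have Y: "(Y \<longlongrightarrow> x) (at_right 0)"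
      unfolding Y_def[abs_def] by (auto intro!: tendsto_eq_intros)
    have "\<forall>\<^sub>F h in at_right 0. Y h $ j \<noteq> 0" for j
    proof (cases "x $ j < 0")
      case True
      then show ?thesis
        unfolding eventually_at_right_field by (intro exI[of _ "- x $ j"]) (auto simp: Y_def)
    next
      case False
      then show ?thesis
        unfolding eventually_at_right_field by (intro exI[of _ 1]) (auto simp: Y_def)
    qed
    then have "\<forall>\<^sub>F h in at_right 0. \<forall>j. Y h $ j \<noteq> 0"
      by (rule eventually_all_finite)
    moreover have "\<forall>\<^sub>F h in at_right 0. real k < norm (Y h)"
      using x(2) by (intro order_tendstoD(1)[OF tendsto_norm[OF Y]]) simp
    moreover have "\<forall>\<^sub>F h in at_right 0. \<forall>i. \<bar>poly_map p (Y h) $ i\<bar> < M + 1"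
    proof (rule eventually_all_finite)
      fix i
      have "isCont (principal_part (p $ i) UNIV) x"
        using has_derivative_continuous[OF has_derivative_principal_part] .
      from isCont_tendsto_compose[OF this Y]
      have "((\<lambda>h. poly_map p (Y h) $ i) \<longlongrightarrow> poly_map p x $ i) (at_right 0)"
        by (simp add: poly_map_def poly_fun_eq_principal_part)
      from tendsto_rabs[OF this] show "\<forall>\<^sub>F h in at_right 0. \<bar>poly_map p (Y h) $ i\<bar> < M + 1"
        using x(1)[of i] by (intro order_tendstoD(2)) auto
    qed
    moreover have "\<forall>\<^sub>F h in at_right 0. \<forall>i. norm (?g i (Y h) - ?g i x) < e"
    proof (rule eventually_all_finite)
      fix i
      have "isCont (?g i) x"
        using continuous_principal_gradient[of UNIV "p $ i" UNIV] by (simp add: continuous_on_eq_continuous_at)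
      from isCont_tendsto_compose[OF this Y]
      have "\<forall>\<^sub>F h in at_right 0. dist (?g i (Y h)) (?g i x) < e"
        using \<open>e > 0\<close> by (rule tendstoD)
      then show "\<forall>\<^sub>F h in at_right 0. norm (?g i (Y h) - ?g i x) < e"
        by (simp add: dist_norm)
    qed
    ultimately have "\<forall>\<^sub>F h in at_right 0. (\<forall>j. Y h $ j \<noteq> 0) \<and> real k < norm (Y h) \<and>
        (\<forall>i. \<bar>poly_map p (Y h) $ i\<bar> < M + 1) \<and> (\<forall>i. norm (?g i (Y h) - ?g i x) < e)"
      by eventually_elim auto
    from eventually_happens'[OF trivial_limit_at_right_real this] obtain h where
      h: "\<forall>j. Y h $ j \<noteq> 0" "real k < norm (Y h)" "\<forall>i. \<bar>poly_map p (Y h) $ i\<bar> < M + 1"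
        "\<forall>i. norm (?g i (Y h) - ?g i x) < e"
      by blast
    have "?bad (2 / real (Suc k)) (Y h)"
    proof (intro allI impI)
      fix v :: "real ^ 'n" assume v: "norm v \<le> 1"
      then obtain i where i: "?g i x \<bullet> v > - e" using x(3) by blast
      have "\<bar>(?g i (Y h) - ?g i x) \<bullet> v\<bar> \<le> norm (?g i (Y h) - ?g i x) * norm v"
        by (rule Cauchy_Schwarz_ineq2)
      also have "\<dots> \<le> norm (?g i (Y h) - ?g i x) * 1"
        using v by (intro mult_left_mono) auto
      also have "\<dots> < e" using h(4) by simp
      finally have "?g i (Y h) \<bullet> v > - (2 * e)"
        using i by (simp add: inner_diff_left)
      then show "\<exists>i. ?g i (Y h) \<bullet> v > - (2 / real (Suc k))"
        by (auto simp: e_def)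
    qed
    then show ?thesis
      using h by (intro exI[of _ "Y h"]) (auto intro: less_imp_le)
  qed
  then obtain y where y: "\<And>k j. y k $ j \<noteq> 0" "\<And>k. real k < norm (y k)"
    "\<And>k i. \<bar>poly_map p (y k) $ i\<bar> \<le> M + 1" "\<And>k. ?bad (2 / real (Suc k)) (y k)"
    by metis
  have "filterlim (\<lambda>k. norm (y k)) at_top sequentially"
    by (rule filterlim_at_top_mono[OF filterlim_real_sequentially])
      (use y(2) in \<open>auto intro!: always_eventually less_imp_le\<close>)
  from descent_along_sequence[OF conv khov y(1) this y(3)] obtain r c where
    r: "strict_mono (r :: nat \<Rightarrow> nat)" and "c > 0" and
    ev: "\<forall>\<^sub>F k in sequentially. \<exists>v. norm v \<le> 1 \<and> (\<forall>i. ?g i (y (r k)) \<bullet> v \<le> - c)"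
    by blast
  have "(\<lambda>k. 2 * inverse (real (Suc k))) \<longlonglongrightarrow> 2 * 0"
    by (intro tendsto_intros LIMSEQ_inverse_real_of_nat)
  then have "(\<lambda>k. 2 * inverse (real (Suc (r k)))) \<longlonglongrightarrow> 0"
    using LIMSEQ_subseq_LIMSEQ[OF _ r, of "\<lambda>k. 2 * inverse (real (Suc k))" 0] by (simp add: o_def)
  then have "\<forall>\<^sub>F k in sequentially. 2 * inverse (real (Suc (r k))) < c"
    using \<open>c > 0\<close> by (rule order_tendstoD)
  with ev have "\<forall>\<^sub>F k in sequentially. False"
  proof eventually_elim
    case (elim k)
    then obtain v where v: "norm v \<le> 1" "\<And>i. ?g i (y (r k)) \<bullet> v \<le> - c" by blast
    with y(4)[of "r k"] obtain i where "?g i (y (r k)) \<bullet> v > - (2 / real (Suc (r k)))" by blast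
    with v(2)[of i] elim(2) show False by (simp add: divide_inverse)
  qed
  then show False by simp
qed

theorem corollary4p3:
  fixes f :: "real ^ 'n::finite \<Rightarrow> real ^ 'm::finite"
    and p :: "'n polynomial ^ 'm"
  assumes "f = poly_map p"
    and "convenient_map p"
    and "khovanskii_nondegenerate p"
    and "\<exists>t\<in>range f. section_bounded (range f) t"
  shows "\<exists>x. pareto_solution f x"
proof -
  obtain x0 a where a: "set_section (range f) (f x0) \<subseteq> (\<lambda>v. a + v) ` nonneg_orthant"
    using assms(4) by (auto simp: section_bounded_def)
  \<comment> \<open>The section at \<open>f x0\<close> is the image of this sublevel set, so its
    boundedness bounds every component from below there.\<close>
  have lower: "a $ i \<le> f x $ i" if "\<forall>i. f x $ i \<le> f x0 $ i" for x i
  proof -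
    have "f x0 - f x \<in> nonneg_orthant"
      using that by (simp add: nonneg_orthant_def)
    then have "f x \<in> set_section (range f) (f x0)"
      by (auto simp: set_section_def image_iff intro!: bexI[of _ "f x0 - f x"])
    then obtain v where "f x = a + v" "v \<in> nonneg_orthant" using a by blast
    then show ?thesis by (simp add: nonneg_orthant_def)
  qed
  \<comment> \<open>On the sublevel set each component lies between those of \<open>a\<close> and
    \<open>f x0\<close>.\<close>
  define M where "M = norm a + norm (f x0)"
  obtain R c where "c > 0" and descent: "\<And>x. \<forall>i. \<bar>poly_map p x $ i\<bar> \<le> M \<Longrightarrow> R \<le> norm x \<Longrightarrow>
      \<exists>v. norm v \<le> 1 \<and> (\<forall>i. principal_gradient (p $ i) UNIV x \<bullet> v \<le> - c)"
    using descent_at_infinity[OF assms(2,3), of M] by blast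
  show ?thesis
  proof (rule pareto_solution_if_descent[where t = "f x0", OF _ _ lower \<open>c > 0\<close>])
    show "((\<lambda>x. f x $ i) has_derivative (\<lambda>h. principal_gradient (p $ i) UNIV x \<bullet> h)) (at x)" for i x
      by (simp add: assms(1) poly_map_def poly_fun_eq_principal_part has_derivative_principal_part)
    show "\<forall>i. f x0 $ i \<le> f x0 $ i" by simp
    fix x assume x: "\<forall>i. f x $ i \<le> f x0 $ i" "R \<le> norm x"
    have "\<bar>f x $ i\<bar> \<le> M" for i
    proof -
      have "\<bar>a $ i\<bar> \<le> norm a" "\<bar>f x0 $ i\<bar> \<le> norm (f x0)"
        by (rule component_le_norm_cart)+
      then show ?thesis
        using lower[OF x(1), of i] x(1)[rule_format, of i] by (simp add: M_def)
    qed
    then show "\<exists>v. norm v \<le> 1 \<and> (\<forall>i. principal_gradient (p $ i) UNIV x \<bullet> v \<le> - c)"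
      using descent x(2) by (simp add: assms(1))
  qed
qed

end
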